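(* For all sufficiently large $k\in\mathbb{N}$, the VC dimension of $k$-hop visibility in polyominoes with holes is $4$. That is, there exists $k_0\in\mathbb{N}$ such that for every integer $k\ge k_0$: there exist a polyomino $P$ (with holes) and a set of $4$ unit squares of $P$ that is shattered by $k$-hop visibility in $P$, and for every polyomino $P$ (possibly with holes) no set of $5$ unit squares of $P$ is shattered by $k$-hop visibility in $P$.
   Context: A polyomino $P$ of size $n$ is a connected polygon in the plane formed by joining together $n$ unit squares (cells) of the square lattice; it may have holes. Its dual graph $G_P$ has one vertex at the center point of each cell of $P$, and two vertices are adjacent if and only if the respective cells share an edge; $G_P$ is connected. $P$ is simple (has no holes) if every inner (bounded) face of $G_P$ (with its natural straight-line embedding) has unit area; otherwise it has holes. A unit square $v\in P$ is $k$-hop-visible from a unit square $u\in P$ if the shortest path from $u$ to $v$ in $G_P$ has length (number of edges) at most $k$. A finite set $D$ of unit squares (guards) of $P$ is shattered (by $k$-hop visibility in $P$) if for each of the $2^{|D|}$ subsets $D_i\subseteq D$ there exists a unit square $u\in P$ (a viewpoint) such that every unit square of $D_i$ is $k$-hop-visible from $u$, but no unit square of $D\setminus D_i$ is $k$-hop-visible from $u$. The VC dimension of $k$-hop visibility in a class of polyominoes is the largest $d$ such that there exist a polyomino $P$ in the class and a set $D$ of $d$ unit squares of $P$ that is shattered. *)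

theory Defs
  imports "HOL-Analysis.Analysis"
begin

text \<open>A cell is a unit square of the square lattice, represented by its center; coordinates are
  chosen such that the centers are the points of the integer lattice.\<close>

type_synonym cell = "int \<times> int"

definition share_edge :: "cell \<Rightarrow> cell \<Rightarrow> bool" where
  "share_edge u v \<longleftrightarrow> \<bar>fst u - fst v\<bar> + \<bar>snd u - snd v\<bar> = 1"

text \<open>The (symmetric) edge relation of the dual graph, whose vertex set is \<open>P\<close> itself.\<close>

definition dual_edges :: "cell set \<Rightarrow> cell rel" where
  "dual_edges P = {(u, v). u \<in> P \<and> v \<in> P \<and> share_edge u v}"

definition polyomino :: "cell set \<Rightarrow> bool" where
  "polyomino P \<longleftrightarrow> finite P \<and> P \<noteq> {} \<and> (\<forall>u\<in>P. \<forall>v\<in>P. (u, v) \<in> (dual_edges P)\<^sup>*)"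

definition center :: "cell \<Rightarrow> real \<times> real" where
  "center u = (of_int (fst u), of_int (snd u))"

definition dual_drawing :: "cell set \<Rightarrow> (real \<times> real) set" where
  "dual_drawing P =
     center ` P \<union> (\<Union>(u, v)\<in>dual_edges P. closed_segment (center u) (center v))"

definition inner_faces :: "cell set \<Rightarrow> (real \<times> real) set set" where
  "inner_faces P = {F \<in> components (- dual_drawing P). bounded F}"

definition simple_polyomino :: "cell set \<Rightarrow> bool" where
  "simple_polyomino P \<longleftrightarrow> polyomino P \<and> (\<forall>F\<in>inner_faces P. measure lebesgue F = 1)"

definition polyomino_with_holes :: "cell set \<Rightarrow> bool" where
  "polyomino_with_holes P \<longleftrightarrow> polyomino P \<and> \<not> simple_polyomino P"

text \<open>Length of a shortest path in the dual graph; meaningful for cells \<open>u\<close> and \<open>v\<close> of a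
  polyomino, where the connectedness of the dual graph guarantees that a path exists.\<close>

definition hop_dist :: "cell set \<Rightarrow> cell \<Rightarrow> cell \<Rightarrow> nat" where
  "hop_dist P u v = (LEAST n. (u, v) \<in> dual_edges P ^^ n)"

text \<open>\<open>hop_visible k P u v\<close>: the cell \<open>v\<close> is \<open>k\<close>-hop-visible from the cell \<open>u\<close>.\<close>

definition hop_visible :: "nat \<Rightarrow> cell set \<Rightarrow> cell \<Rightarrow> cell \<Rightarrow> bool" where
  "hop_visible k P u v \<longleftrightarrow> u \<in> P \<and> v \<in> P \<and> hop_dist P u v \<le> k"

definition shattered :: "nat \<Rightarrow> cell set \<Rightarrow> cell set \<Rightarrow> bool" where
  "shattered k P D \<longleftrightarrow> finite D \<and> D \<subseteq> P \<and>
     (\<forall>S\<subseteq>D. \<exists>u\<in>P. (\<forall>v\<in>S. hop_visible k P u v) \<and> (\<forall>v\<in>D - S. \<not> hop_visible k P u v))"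

text \<open>\<open>has_vc_dimension k C d\<close>: the VC dimension of \<open>k\<close>-hop visibility in the class \<open>C\<close> exists
  and equals \<open>d\<close>. This is a relation because the maximum need not exist for every class.\<close>

definition has_vc_dimension :: "nat \<Rightarrow> cell set set \<Rightarrow> nat \<Rightarrow> bool" where
  "has_vc_dimension k C d \<longleftrightarrow>
     (\<exists>P\<in>C. \<exists>D. shattered k P D \<and> card D = d) \<and>
     (\<forall>P\<in>C. \<forall>D. shattered k P D \<longrightarrow> card D \<le> d)"

end

theory Submission
  imports Defs "HOL-Library.Z2"
begin

text \<open>Upper bound: given five shattered guards, join each pair by shortest paths to a viewpoint
  that sees exactly these two. Paths of disjoint pairs are vertex-disjoint, since from a common cell
  one of the two viewpoints could reach a guard that it must not see; and no path contains a third
  guard. This would be a planar drawing of \<open>K\<^sub>5\<close> in which only adjacent edges meet, which a parity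
  count of crossings in the lattice excludes.

  Lower bound: a fixed finite grid graph has four vertices that are shattered by balls of radius 4.
  Replacing each edge by a straight corridor of length \<open>m = k div 4\<close> multiplies all distances by
  \<open>m\<close>, and for \<open>k \<ge> 16\<close> a multiple of \<open>m\<close> is at most \<open>k\<close> iff it is at most \<open>4 m\<close>. A unit square
  of the grid graph becomes an inner face of area \<open>m\<^sup>2 \<noteq> 1\<close>.\<close>

declare add_bit_eq_xor [simp del]

text \<open>Cancellation in characteristic 2. The second equation reaches summands inside the
  right-nested sums that \<open>ac_simps\<close> produces.\<close>

lemma bit_add_self [simp]: "x + x = (0 :: bit)" "x + (x + y) = (y :: bit)"
  by (cases x; cases y; simp add: add_bit_eq_xor)+

section \<open>Crossings modulo 2 of chains in the square lattice\<close>

text \<open>A unit edge is given by its left or lower endpoint and a flag saying whether it is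
  vertical.\<close>

type_synonym unit_edge = "cell \<times> bool"

fun upper :: "unit_edge \<Rightarrow> cell" where
  "upper ((x, y), vertical) = (if vertical then (x, y + 1) else (x + 1, y))"

definition ends :: "unit_edge list \<Rightarrow> cell set" where
  "ends A = fst ` set A \<union> upper ` set A"

text \<open>The boundary of \<open>A\<close> modulo 2 is \<open>a + b\<close>, tested against all
  functions \<open>g\<close>. Edges may come in any order and repeat, so walks can be concatenated
  without being simplified, and \<open>a = b\<close> describes a closed chain.\<close>

definition chain_joins :: "unit_edge list \<Rightarrow> cell \<Rightarrow> cell \<Rightarrow> bool" where
  "chain_joins A a b \<longleftrightarrow>
     (\<forall>g :: cell \<Rightarrow> bit. (\<Sum>e\<leftarrow>A. g (fst e) + g (upper e)) = g a + g b)"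

lemma chain_joinsD:
  "chain_joins A a b \<Longrightarrow> (\<Sum>e\<leftarrow>A. g (fst e) + g (upper e)) = g a + (g b :: bit)"
  by (simp add: chain_joins_def)

lemma chain_joins_sym: "chain_joins A a b \<Longrightarrow> chain_joins A b a"
  by (simp add: chain_joins_def add.commute)

lemma chain_joins_append:
  assumes "chain_joins A a b" "chain_joins B b c"
  shows "chain_joins (A @ B) a c"
  using assms by (simp add: chain_joins_def ac_simps)

lemma ends_append [simp]: "ends (A @ B) = ends A \<union> ends B"
  by (auto simp: ends_def)

text \<open>Whether the first edge meets the second one shifted by \<open>(1/2, 1/2)\<close>. Thanks to the shift,
  chains are always in general position, and chains without common vertices do not cross.\<close>

fun cross :: "unit_edge \<Rightarrow> unit_edge \<Rightarrow> bit" where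
  "cross (p, d) (r, e) = of_bool (d \<noteq> e \<and> upper (r, e) = p)"

definition crossings :: "unit_edge list \<Rightarrow> unit_edge list \<Rightarrow> bit" where
  "crossings A B = (\<Sum>e\<leftarrow>A. \<Sum>f\<leftarrow>B. cross e f)"

lemma crossings_append [simp]:
  "crossings (A @ A') B = crossings A B + crossings A' B"
  "crossings A (B @ B') = crossings A B + crossings A B'"
  by (simp_all add: crossings_def sum_list_addf)

lemma sum_list_swap:
  "(\<Sum>x\<leftarrow>xs. \<Sum>y\<leftarrow>ys. f x y) = (\<Sum>y\<leftarrow>ys. \<Sum>x\<leftarrow>xs. f x y :: 'a :: comm_monoid_add)"
  by (induction xs) (simp_all add: sum_list_addf)

lemma crossings_disjoint:
  assumes "ends A \<inter> ends B = {}"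
  shows "crossings A B = 0"
proof -
  have "cross e f = 0" if "e \<in> set A" "f \<in> set B" for e f
  proof -
    have "fst e \<in> ends A" "upper f \<in> ends B" using that by (auto simp: ends_def)
    then have "upper f \<noteq> fst e" using assms by auto
    then show ?thesis by (cases e; cases f) simp
  qed
  then have "(\<Sum>e\<leftarrow>A. \<Sum>f\<leftarrow>B. cross e f) = (\<Sum>e\<leftarrow>A. \<Sum>f\<leftarrow>B. 0)"
    by (intro arg_cong[where f = sum_list] map_cong refl) auto
  then show ?thesis by (simp add: crossings_def)
qed

text \<open>The ray starts at the cell shifted by \<open>(1/2, 1/2)\<close> and runs to the right, so that summing
  over a closed chain yields its winding number modulo 2 around that point.\<close>

fun hits_ray :: "cell \<Rightarrow> unit_edge \<Rightarrow> bit" where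
  "hits_ray (x, y) ((x', y'), vertical) = of_bool (vertical \<and> y' = y \<and> x < x')"

text \<open>If \<open>f\<close> is horizontal, the rays from its two ends differ exactly by the
  shifted \<open>f\<close>, and \<open>g\<close> is 0. If \<open>f\<close> is vertical, the two rays
  and the shifted \<open>f\<close> bound a half-strip whose lattice points are marked by
  \<open>g\<close>; an edge meets this boundary an odd number of times iff exactly one of its ends
  lies inside.\<close>

lemma cross_eq_hits_ray:
  "\<exists>g. \<forall>e. cross e f =
     hits_ray (fst f) e + hits_ray (upper f) e + (g (fst e) + g (upper e))"
proof -
  obtain x y d where f: "f = ((x, y), d)" by (metis prod.collapse)
  define g :: "cell \<Rightarrow> bit" where
    "g c = of_bool (d \<and> snd c = y + 1 \<and> fst c > x)" for c
  have "cross e f = hits_ray (fst f) e + hits_ray (upper f) e + (g (fst e) + g (upper e))" for e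
  proof -
    obtain x' y' d' where e: "e = ((x', y'), d')" by (metis prod.collapse)
    show ?thesis unfolding e f g_def
      by (cases d; cases d') (auto simp: of_bool_def)
  qed
  then show ?thesis by blast
qed

text \<open>The crossings of the closed chain \<open>A\<close> with one edge \<open>f\<close> are
  the change of its winding number \<open>w\<close> between the ends of \<open>f\<close>, as the
  \<open>g\<close> terms cancel around \<open>A\<close>. Around the closed chain \<open>B\<close>
  these changes add up to 0.\<close>

lemma crossings_closed:
  assumes A: "chain_joins A a a" and B: "chain_joins B b b"
  shows "crossings A B = 0"
proof -
  define w where "w c = (\<Sum>e\<leftarrow>A. hits_ray c e)" for c
  have "(\<Sum>e\<leftarrow>A. cross e f) = w (fst f) + w (upper f)" for f
  proof -
    obtain g where g: "\<And>e. cross e f =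
        hits_ray (fst f) e + hits_ray (upper f) e + (g (fst e) + g (upper e))"
      using cross_eq_hits_ray by metis
    show ?thesis using chain_joinsD[OF A, of g]
      by (simp only: g sum_list_addf w_def) simp
  qed
  then have "crossings A B = (\<Sum>f\<leftarrow>B. w (fst f) + w (upper f))"
    unfolding crossings_def by (subst sum_list_swap) simp
  also have "\<dots> = 0" using chain_joinsD[OF B, of w] by simp
  finally show ?thesis .
qed

text \<open>The edges met on the way from \<open>c - (1/2, 1/2)\<close> via \<open>c + (1/2, -1/2)\<close> to \<open>c + (1/2, 1/2)\<close>.
  They account for the asymmetry of \<open>cross\<close>, since exchanging its arguments amounts to shifting by
  \<open>(-1/2, -1/2)\<close> instead.\<close>

fun south_east :: "cell \<Rightarrow> unit_edge \<Rightarrow> bit" where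
  "south_east c (p, vertical) = of_bool (if vertical then upper (p, vertical) = c else p = c)"

lemma south_east_0: "c \<notin> ends A \<Longrightarrow> (\<Sum>e\<leftarrow>A. south_east c e) = 0"
proof (induction A)
  case (Cons e A)
  then show ?case by (cases e) (auto simp: ends_def)
qed simp

text \<open>A case check over both directions. The corrections are grouped into sums over both ends
  of an edge, so that \<open>chain_joins\<close> can collapse them to the ends of a chain.\<close>

lemma cross_swap:
  "cross e f + cross f e =
     (south_east (fst f) e + south_east (upper f) e) +
     (south_east (fst e) f + south_east (upper e) f) +
     ((of_bool (fst e = fst f) + of_bool (upper e = fst f)) +
      (of_bool (fst e = upper f) + of_bool (upper e = upper f)))"
proof -
  obtain x y d x' y' d' where "e = ((x, y), d)" "f = ((x', y'), d')" by (metis prod.collapse)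
  then show ?thesis
    by (cases d; cases d') (auto simp: of_bool_def)
qed

text \<open>After summing \<open>cross_swap\<close>, the \<open>south_east\<close> terms survive
  only at \<open>p\<close>, because \<open>a\<close> and \<open>b\<close> do not lie on the other
  chain. The summand 1 counts \<open>p\<close> as the only common element of the boundaries
  \<open>{p, a}\<close> and \<open>{p, b}\<close>.\<close>

lemma crossings_swap:
  assumes A: "chain_joins A p a" and B: "chain_joins B p b"
    and "a \<notin> ends B" "b \<notin> ends A" "p \<noteq> a" "p \<noteq> b" "a \<noteq> b"
  shows "crossings A B + crossings B A =
    (\<Sum>e\<leftarrow>A. south_east p e) + (\<Sum>e\<leftarrow>B. south_east p e) + 1"
proof -
  have "crossings A B + crossings B A = (\<Sum>e\<leftarrow>A. \<Sum>f\<leftarrow>B. cross e f + cross f e)"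
    by (simp add: crossings_def sum_list_addf sum_list_swap[of _ A])
  also have "\<dots> =
      (\<Sum>f\<leftarrow>B. (\<Sum>e\<leftarrow>A. south_east (fst f) e) + (\<Sum>e\<leftarrow>A. south_east (upper f) e)) +
      (\<Sum>e\<leftarrow>A. (\<Sum>f\<leftarrow>B. south_east (fst e) f) + (\<Sum>f\<leftarrow>B. south_east (upper e) f)) +
      (\<Sum>f\<leftarrow>B. (\<Sum>e\<leftarrow>A. of_bool (fst e = fst f) + of_bool (upper e = fst f)) +
               (\<Sum>e\<leftarrow>A. of_bool (fst e = upper f) + of_bool (upper e = upper f)))"
    unfolding cross_swap
    by (simp only: sum_list_addf sum_list_swap[of _ B A])
  also have "(\<Sum>f\<leftarrow>B. (\<Sum>e\<leftarrow>A. south_east (fst f) e) + (\<Sum>e\<leftarrow>A. south_east (upper f) e)) =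
      (\<Sum>e\<leftarrow>A. south_east p e)"
    using chain_joinsD[OF B, of "\<lambda>c. \<Sum>e\<leftarrow>A. south_east c e"] assms by (simp add: south_east_0)
  also have "(\<Sum>e\<leftarrow>A. (\<Sum>f\<leftarrow>B. south_east (fst e) f) + (\<Sum>f\<leftarrow>B. south_east (upper e) f)) =
      (\<Sum>f\<leftarrow>B. south_east p f)"
    using chain_joinsD[OF A, of "\<lambda>c. \<Sum>f\<leftarrow>B. south_east c f"] assms by (simp add: south_east_0)
  also have "(\<Sum>f\<leftarrow>B. (\<Sum>e\<leftarrow>A. of_bool (fst e = fst f) + of_bool (upper e = fst f)) +
       (\<Sum>e\<leftarrow>A. of_bool (fst e = upper f) + of_bool (upper e = upper f))) = (1 :: bit)"
    using chain_joinsD[OF B, of "\<lambda>c. of_bool (p = c) + of_bool (a = c)"] assms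
    by (simp add: chain_joinsD[OF A, of "\<lambda>d. of_bool (d = _)"])
  finally show ?thesis .
qed

text \<open>Only the four chains at \<open>p\<close> can cross each other. By \<open>crossings_swap\<close>,
  \<open>?X x y + ?d x\<close> is a tournament on the other four vertices, so that the sum of \<open>?X\<close> over the
  six ordered pairs from \<open>{a, b, c}\<close> is odd. Adding up the vanishing crossings of the three pairs
  of triangles that meet only in \<open>p\<close> makes the same sum even.\<close>

lemma no_K5_chains:
  fixes C :: "cell set \<Rightarrow> unit_edge list"
  assumes V: "p \<in> V" "v \<in> V" "a \<in> V" "b \<in> V" "c \<in> V" and dist: "distinct [p, v, a, b, c]"
    and joins: "\<And>x y. \<lbrakk>x \<in> V; y \<in> V; x \<noteq> y\<rbrakk> \<Longrightarrow> chain_joins (C {x, y}) x y"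
    and avoid: "\<And>x y z. \<lbrakk>x \<in> V; y \<in> V; z \<in> V; distinct [x, y, z]\<rbrakk> \<Longrightarrow> z \<notin> ends (C {x, y})"
    and disj: "\<And>x y x' y'. \<lbrakk>x \<in> V; y \<in> V; x' \<in> V; y' \<in> V; distinct [x, y, x', y']\<rbrakk> \<Longrightarrow>
      ends (C {x, y}) \<inter> ends (C {x', y'}) = {}"
  shows False
proof -
  let ?X = "\<lambda>x y. crossings (C {p, x}) (C {p, y})"
  let ?d = "\<lambda>x. \<Sum>e\<leftarrow>C {p, x}. south_east p e"
  have swap: "?X x y + ?X y x = ?d x + ?d y + 1"
    if "x \<in> V" "y \<in> V" "distinct [p, x, y]" for x y
    using that V by (intro crossings_swap[of _ _ x _ y] joins avoid) auto
  have triangle: "chain_joins (C {p, x} @ C {x, y} @ C {p, y}) p p"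
    if "x \<in> V" "y \<in> V" "distinct [p, x, y]" for x y
    using that V by (intro chain_joins_append[of _ p x] chain_joins_append[of _ x y]
        joins chain_joins_sym[OF joins[of p y]]) auto
  have disj': "crossings (C {q, q'}) (C {r, r'}) = 0"
    if "q \<in> V" "q' \<in> V" "r \<in> V" "r' \<in> V" "distinct [q, q', r, r']" for q q' r r'
    using that by (intro crossings_disjoint disj)
  have split: "?X x z + ?X x z' + ?X y z + ?X y z' = 0"
    if "x \<in> V" "y \<in> V" "z \<in> V" "z' \<in> V" "distinct [p, x, y, z, z']" for x y z z'
  proof -
    \<comment> \<open>Of the nine pairs of sides, all but the four in which both sides contain
      \<open>p\<close> are disjoint.\<close>
    have "crossings (C {p, x} @ C {x, y} @ C {p, y}) (C {p, z} @ C {z, z'} @ C {p, z'}) = 0"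
      using that by (intro crossings_closed[of _ p _ p] triangle) auto
    moreover have "x \<noteq> p" "y \<noteq> p" "z \<noteq> p" "z' \<noteq> p" using that(5) by auto
    ultimately show ?thesis using that V by (simp add: disj' ac_simps)
  qed
  have "?X v a + ?X v b + ?X c a + ?X c b = 0" "?X v a + ?X v c + ?X b a + ?X b c = 0"
       "?X v b + ?X v c + ?X a b + ?X a c = 0"
    using V dist by (auto intro!: split)
  then have "(?X v a + ?X v b + ?X c a + ?X c b) + (?X v a + ?X v c + ?X b a + ?X b c) +
      (?X v b + ?X v c + ?X a b + ?X a c) = 0"
    by (simp only: add_0)
  \<comment> \<open>Each crossing \<open>?X v _\<close> occurs twice and cancels, which leaves the
    six ordered pairs from \<open>a\<close>, \<open>b\<close>, \<open>c\<close>.\<close>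
  then have "(?X a b + ?X b a) + (?X a c + ?X c a) + (?X b c + ?X c b) = 0"
    by (simp add: ac_simps)
  moreover have "?X a b + ?X b a = ?d a + ?d b + 1" "?X a c + ?X c a = ?d a + ?d c + 1"
      "?X b c + ?X c b = ?d b + ?d c + 1"
    using V dist by (auto intro!: swap)
  ultimately have "(?d a + ?d b + 1) + (?d a + ?d c + 1) + (?d b + ?d c + 1) = 0" by (simp only:)
  then show False by (simp add: ac_simps)
qed

section \<open>No five cells are shattered\<close>

lemma hop_dist_le: "(u, v) \<in> dual_edges P ^^ n \<Longrightarrow> hop_dist P u v \<le> n"
  unfolding hop_dist_def by (rule Least_le)

lemma hop_dist_path:
  assumes "polyomino P" "u \<in> P" "v \<in> P"
  shows "(u, v) \<in> dual_edges P ^^ hop_dist P u v"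
proof -
  obtain n where "(u, v) \<in> dual_edges P ^^ n"
    using assms rtrancl_imp_relpow unfolding polyomino_def by blast
  then show ?thesis unfolding hop_dist_def by (rule LeastI)
qed

lemma dual_edges_cases [consumes 1, case_names right left up down]:
  assumes "(u, v) \<in> dual_edges P"
  obtains X Y where "u = (X, Y)" "v = (X + 1, Y)" "u \<in> P" "v \<in> P"
    | X Y where "v = (X, Y)" "u = (X + 1, Y)" "u \<in> P" "v \<in> P"
    | X Y where "u = (X, Y)" "v = (X, Y + 1)" "u \<in> P" "v \<in> P"
    | X Y where "v = (X, Y)" "u = (X, Y + 1)" "u \<in> P" "v \<in> P"
proof -
  obtain x y x' y' where uv: "u = (x, y)" "v = (x', y')" by fastforce
  have "\<bar>x - x'\<bar> + \<bar>y - y'\<bar> = 1" and P: "u \<in> P" "v \<in> P"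
    using assms by (auto simp: dual_edges_def share_edge_def uv)
  then consider "x' = x + 1" "y' = y" | "x = x' + 1" "y' = y" | "x' = x" "y' = y + 1"
    | "x' = x" "y = y' + 1" by linarith
  then show thesis
  proof cases
    case 1
    show thesis by (rule that(1)[OF _ _ P, of x y]) (simp_all only: uv 1)
  next
    case 2
    show thesis by (rule that(2)[OF _ _ P, of x' y']) (simp_all only: uv 2)
  next
    case 3
    show thesis by (rule that(3)[OF _ _ P, of x y]) (simp_all only: uv 3)
  next
    case 4
    show thesis by (rule that(4)[OF _ _ P, of x' y']) (simp_all only: uv 4)
  qed
qed

lemma dual_edge_chain:
  assumes "(u, v) \<in> dual_edges P"
  shows "\<exists>e. chain_joins [e] u v \<and> ends [e] = {u, v}"
  using assms
proof (cases rule: dual_edges_cases)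
  case (right X Y)
  then show ?thesis
    by (intro exI[of _ "((X, Y), False)"]) (simp add: chain_joins_def ends_def insert_commute)
next
  case (left X Y)
  then show ?thesis
    by (intro exI[of _ "((X, Y), False)"])
      (simp add: chain_joins_def ends_def insert_commute add.commute)
next
  case (up X Y)
  then show ?thesis
    by (intro exI[of _ "((X, Y), True)"]) (simp add: chain_joins_def ends_def insert_commute)
next
  case (down X Y)
  then show ?thesis
    by (intro exI[of _ "((X, Y), True)"])
      (simp add: chain_joins_def ends_def insert_commute add.commute)
qed

text \<open>The split \<open>i + j = n\<close> is recorded at every cell of the walk so that the
  tails of two walks can be exchanged at a common cell.\<close>

lemma relpow_chain:
  assumes "(u, v) \<in> dual_edges P ^^ n"
  shows "\<exists>A. chain_joins A u v \<and>
    (\<forall>w\<in>ends A. \<exists>i j. i + j = n \<and> (u, w) \<in> dual_edges P ^^ i \<and> (w, v) \<in> dual_edges P ^^ j)"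
  using assms
proof (induction n arbitrary: v)
  case 0
  then show ?case by (intro exI[of _ "[]"]) (simp add: chain_joins_def ends_def)
next
  case (Suc n)
  let ?R = "dual_edges P"
  obtain x where x: "(u, x) \<in> ?R ^^ n" "(x, v) \<in> ?R"
    using Suc.prems by auto
  obtain A where A: "chain_joins A u x"
    "\<And>w. w \<in> ends A \<Longrightarrow> \<exists>i j. i + j = n \<and> (u, w) \<in> ?R ^^ i \<and> (w, x) \<in> ?R ^^ j"
    using Suc.IH[OF x(1)] by blast
  obtain e where e: "chain_joins [e] x v" "ends [e] = {x, v}"
    using dual_edge_chain[OF x(2)] by blast
  have "\<exists>i j. i + j = Suc n \<and> (u, w) \<in> ?R ^^ i \<and> (w, v) \<in> ?R ^^ j" if w: "w \<in> ends (A @ [e])" for w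
  proof -
    consider "w \<in> ends A" | "w = x" | "w = v" using w unfolding ends_append e(2) by blast
    then show ?thesis
    proof cases
      case 1
      then obtain i j where "i + j = n" "(u, w) \<in> ?R ^^ i" "(w, x) \<in> ?R ^^ j" using A(2) by blast
      then show ?thesis using x(2) by (intro exI[of _ i] exI[of _ "Suc j"]) auto
    next
      case 2
      then show ?thesis using x by (intro exI[of _ n] exI[of _ 1]) auto
    next
      case 3
      then show ?thesis using Suc.prems by (intro exI[of _ "Suc n"] exI[of _ 0]) auto
    qed
  qed
  then show ?case using chain_joins_append[OF A(1) e(1)] by blast
qed

lemma shattered_card_le_4:
  assumes P: "polyomino P" and D: "shattered k P D"
  shows "card D \<le> 4"
proof (rule ccontr)
  assume "\<not> card D \<le> 4"
  then obtain F where F: "F \<subseteq> D" "card F = 5"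
    using obtain_subset_with_card_n[of 5 D] by auto
  let ?R = "dual_edges P"
  define near where "near u w s \<longleftrightarrow>
    (\<exists>i j. i + j \<le> k \<and> (u, w) \<in> ?R ^^ i \<and> (w, s) \<in> ?R ^^ j)" for u w s
  have far: "m > k" if "u \<in> P" "t \<in> P" "\<not> hop_visible k P u t" "(u, t) \<in> ?R ^^ m" for u t m
    using that hop_dist_le[of u t m P] by (auto simp: hop_visible_def)
  \<comment> \<open>The chain belongs to the set \<open>S\<close> and is asserted to join its two
    elements in either order; this allows \<open>C\<close> to be indexed by unordered pairs.\<close>
  have ex: "\<exists>A u. u \<in> P \<and> (\<forall>x y. S = {x, y} \<longrightarrow> x \<noteq> y \<longrightarrow> chain_joins A x y) \<and>
      (\<forall>w\<in>ends A. \<exists>s\<in>S. near u w s) \<and> (\<forall>t\<in>D - S. \<not> hop_visible k P u t)"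
    if S: "S \<subseteq> D" "card S = 2" for S
  proof -
    obtain u where u: "u \<in> P" "\<And>s. s \<in> S \<Longrightarrow> hop_visible k P u s"
      "\<And>t. t \<in> D - S \<Longrightarrow> \<not> hop_visible k P u t"
    proof -
      have "\<exists>u\<in>P. (\<forall>v\<in>S. hop_visible k P u v) \<and> (\<forall>v\<in>D - S. \<not> hop_visible k P u v)"
        using D S(1) by (simp add: shattered_def)
      then show thesis using that by (elim bexE conjE) simp
    qed
    have "\<exists>A. chain_joins A u s \<and> (\<forall>w\<in>ends A. near u w s)" if "s \<in> S" for s
    proof -
      have "hop_dist P u s \<le> k" "s \<in> P" using u(2)[OF that] by (auto simp: hop_visible_def)
      obtain A where A: "chain_joins A u s" "\<And>w. w \<in> ends A \<Longrightarrow> \<exists>i j. i + j = hop_dist P u s \<and>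
          (u, w) \<in> ?R ^^ i \<and> (w, s) \<in> ?R ^^ j"
        using relpow_chain[OF hop_dist_path[OF P u(1) \<open>s \<in> P\<close>]] by blast
      have "near u w s" if "w \<in> ends A" for w
        using A(2)[OF that] \<open>hop_dist P u s \<le> k\<close> unfolding near_def by metis
      with A(1) show ?thesis by blast
    qed
    then obtain B where B: "\<And>s. s \<in> S \<Longrightarrow> chain_joins (B s) u s"
      "\<And>s w. s \<in> S \<Longrightarrow> w \<in> ends (B s) \<Longrightarrow> near u w s" by metis
    obtain x y where xy: "S = {x, y}" "x \<noteq> y" using S(2) by (auto simp: card_2_iff)
    have "chain_joins (B x @ B y) x y"
      using B(1)[of x] B(1)[of y] xy by (auto intro: chain_joins_append chain_joins_sym)
    then have "\<forall>x' y'. S = {x', y'} \<longrightarrow> x' \<noteq> y' \<longrightarrow> chain_joins (B x @ B y) x' y'"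
      using xy(1) by (auto simp: doubleton_eq_iff intro: chain_joins_sym)
    moreover have "\<exists>s\<in>S. near u w s" if "w \<in> ends (B x @ B y)" for w
    proof -
      from that consider "w \<in> ends (B x)" | "w \<in> ends (B y)" unfolding ends_append by blast
      then show ?thesis using B(2)[of x w] B(2)[of y w] xy(1) by cases simp_all
    qed
    ultimately show ?thesis
      using u(1,3) by (intro exI[of _ "B x @ B y"] exI[of _ u] conjI ballI) simp_all
  qed
  define good where "good S A u \<longleftrightarrow> u \<in> P \<and>
      (\<forall>x y. S = {x, y} \<longrightarrow> x \<noteq> y \<longrightarrow> chain_joins A x y) \<and>
      (\<forall>w\<in>ends A. \<exists>s\<in>S. near u w s) \<and> (\<forall>t\<in>D - S. \<not> hop_visible k P u t)" for S A u
  have "\<forall>S\<in>{S. S \<subseteq> D \<and> card S = 2}. \<exists>Au. good S (fst Au) (snd Au)"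
    using ex by (simp add: good_def)
  from bchoice[OF this] obtain Cu where
    Cu: "\<forall>S\<in>{S. S \<subseteq> D \<and> card S = 2}. good S (fst (Cu S)) (snd (Cu S))" ..
  define C u where "C S = fst (Cu S)" and "u S = snd (Cu S)" for S
  have good: "good S (C S) (u S)" if "S \<subseteq> D" "card S = 2" for S
    using Cu that by (simp add: C_def u_def)
  have u_in: "u S \<in> P" and near: "\<And>w. w \<in> ends (C S) \<Longrightarrow> \<exists>s\<in>S. near (u S) w s"
    and invisible: "\<And>t. t \<in> D - S \<Longrightarrow> \<not> hop_visible k P (u S) t"
    if "S \<subseteq> D" "card S = 2" for S
    using good[OF that] unfolding good_def Ball_def by iprover+
  have joins: "chain_joins (C {x, y}) x y" if "x \<in> D" "y \<in> D" "x \<noteq> y" for x y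
  proof -
    have "good {x, y} (C {x, y}) (u {x, y})" using that by (intro good) auto
    with \<open>x \<noteq> y\<close> show ?thesis unfolding good_def by iprover
  qed
  have DP: "D \<subseteq> P" using D by (simp add: shattered_def)
  have avoid: "t \<notin> ends (C S)" if S: "S \<subseteq> D" "card S = 2" and t: "t \<in> D - S" for S t
  proof
    assume "t \<in> ends (C S)"
    then obtain i where "i \<le> k" "(u S, t) \<in> ?R ^^ i"
      using near[OF S] unfolding near_def by (metis add_leD1)
    then show False
      using far[OF u_in[OF S] _ invisible[OF S t]] t DP by force
  qed
  have disj: "ends (C S) \<inter> ends (C T) = {}"
    if S: "S \<subseteq> D" "card S = 2" and T: "T \<subseteq> D" "card T = 2" and "S \<inter> T = {}" for S T
  proof (rule ccontr)
    assume "ends (C S) \<inter> ends (C T) \<noteq> {}"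
    then obtain w where w: "w \<in> ends (C S)" "w \<in> ends (C T)" by blast
    obtain s t where "s \<in> S" "t \<in> T" and st: "near (u S) w s" "near (u T) w t"
      using near[OF S w(1)] near[OF T w(2)] by (elim bexE)
    from st obtain i j i' j' where *: "i + j \<le> k" "(u S, w) \<in> ?R ^^ i" "(w, s) \<in> ?R ^^ j"
      "i' + j' \<le> k" "(u T, w) \<in> ?R ^^ i'" "(w, t) \<in> ?R ^^ j'"
      unfolding near_def by blast
    \<comment> \<open>Exchanging the tails at \<open>w\<close> yields two walks to guards that are
      invisible from their viewpoints. Each is longer than \<open>k\<close>, although together they
      have length \<open>(i + j) + (i' + j')\<close>, which is at most \<open>2 * k\<close>.\<close>
    have "(u S, t) \<in> ?R ^^ (i + j')" "(u T, s) \<in> ?R ^^ (i' + j)"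
      using * by (auto simp: relpow_add)
    then have "i + j' > k" "i' + j > k"
      using far[OF u_in[OF S] _ invisible[OF S]] far[OF u_in[OF T] _ invisible[OF T]]
        S(1) T(1) \<open>s \<in> S\<close> \<open>t \<in> T\<close> \<open>S \<inter> T = {}\<close> DP by blast+
    then show False using * by linarith
  qed
  obtain vs where vs: "set vs = F" "distinct vs" "length vs = 5"
    using finite_distinct_list[of F] F(2) distinct_card
    by (metis card.infinite zero_neq_numeral)
  then obtain a1 a2 a3 a4 a5 where "vs = [a1, a2, a3, a4, a5]"
    by (auto simp: length_Suc_conv numeral_eq_Suc)
  with vs F have "distinct [a1, a2, a3, a4, a5]" and sub: "{a1, a2, a3, a4, a5} \<subseteq> D" by auto
  then show False
    by (intro no_K5_chains[of a1 D a2 a3 a4 a5 C] joins disj avoid) auto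
qed

section \<open>Subdivided grid graphs\<close>

lemma sym_dual_edges: "sym (dual_edges P)"
  by (auto simp: sym_def dual_edges_def share_edge_def abs_minus_commute)

lemma relpow_dual_edges_sym:
  "(u, v) \<in> dual_edges P ^^ n \<Longrightarrow> (v, u) \<in> dual_edges P ^^ n"
proof (induction n arbitrary: v)
  case (Suc n)
  then show ?case by (meson relpow_Suc_E relpow_Suc_I2 sym_dual_edges symE)
qed simp

text \<open>A potential that drops by at most 1 per edge bounds distances from below. The given walk
  guarantees that the \<open>LEAST\<close> in \<open>hop_dist\<close> is attained.\<close>

lemma hop_dist_ge:
  fixes F :: "cell \<Rightarrow> int"
  assumes "\<And>u v. (u, v) \<in> dual_edges P \<Longrightarrow> F u \<le> F v + 1"
    and "(u, v) \<in> dual_edges P ^^ n"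
  shows "F u - F v \<le> int (hop_dist P u v)"
proof -
  have "F u \<le> F v + int n" if "(u, v) \<in> dual_edges P ^^ n" for u v n
    using that
  proof (induction n arbitrary: v)
    case (Suc n)
    then obtain w where "(u, w) \<in> dual_edges P ^^ n" "(w, v) \<in> dual_edges P" by auto
    then show ?case using Suc.IH[of w] assms(1)[of w v] by simp
  qed simp
  moreover have "(u, v) \<in> dual_edges P ^^ hop_dist P u v"
    unfolding hop_dist_def using assms(2) by (rule LeastI)
  ultimately have "F u \<le> F v + int (hop_dist P u v)" by blast
  then show ?thesis by simp
qed

text \<open>\<open>H\<close> holds the left endpoints of the horizontal edges of a grid graph and \<open>V\<close> the lower
  endpoints of its vertical edges. Scaling by \<open>m \<ge> 2\<close> ensures that cells on different edges
  share a side only at a common vertex.\<close>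

definition subdivision :: "cell set \<Rightarrow> cell set \<Rightarrow> nat \<Rightarrow> cell set" where
  "subdivision H V m =
     {(x * int m + t, y * int m) | x y t. (x, y) \<in> H \<and> 0 \<le> t \<and> t \<le> int m} \<union>
     {(x * int m, y * int m + t) | x y t. (x, y) \<in> V \<and> 0 \<le> t \<and> t \<le> int m}"

lemma subdivisionI:
  "\<lbrakk>(x, y) \<in> H; 0 \<le> t; t \<le> int m\<rbrakk> \<Longrightarrow> (x * int m + t, y * int m) \<in> subdivision H V m"
  "\<lbrakk>(x, y) \<in> V; 0 \<le> t; t \<le> int m\<rbrakk> \<Longrightarrow> (x * int m, y * int m + t) \<in> subdivision H V m"
  unfolding subdivision_def by blast+

lemma finite_subdivision:
  assumes "finite H" "finite V"
  shows "finite (subdivision H V m)"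
proof -
  have "subdivision H V m \<subseteq>
      (\<lambda>((x, y), t). (x * int m + t, y * int m)) ` (H \<times> {0..int m}) \<union>
      (\<lambda>((x, y), t). (x * int m, y * int m + t)) ` (V \<times> {0..int m})"
    unfolding subdivision_def
    by (rule Un_mono; rule subsetI; clarify; rule_tac x = "((x, y), t)" in image_eqI; simp)
  then show ?thesis using assms by (auto intro: finite_subset)
qed

lemma mult_add_eqD:
  fixes x x' m t t' :: int
  assumes "x * m + t = x' * m + t'" "\<bar>t - t'\<bar> < m"
  shows "x = x'" "t = t'"
proof -
  have "m > 0" using assms(2) by linarith
  have "(x - x') * m = t' - t" using assms(1) by (simp add: algebra_simps)
  then have "\<bar>x - x'\<bar> * m = \<bar>t' - t\<bar>" using \<open>m > 0\<close> by (metis abs_mult abs_of_pos)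
  then have "\<bar>x - x'\<bar> * m < 1 * m" using assms(2) by linarith
  then have "\<bar>x - x'\<bar> < 1" using \<open>m > 0\<close> by (simp only: mult_less_cancel_right_pos)
  then show "x = x'" by simp
  then show "t = t'" using assms(1) by simp
qed

text \<open>A cell that is not on a horizontal corridor has a multiple of \<open>m\<close> as its
  first coordinate. As \<open>m \<ge> 2\<close>, this cannot happen for both \<open>X\<close> and
  \<open>X + 1\<close>, and the corridor through one of them contains the other unless it ends
  there.\<close>

lemma subdivision_horizontal:
  assumes m: "m \<ge> 2" and "(X, Y) \<in> subdivision H V m" "(X + 1, Y) \<in> subdivision H V m"
  obtains x y t where "(x, y) \<in> H" "0 \<le> t" "t < int m" "X = x * int m + t" "Y = y * int m"
proof -
  let ?m = "int m"
  consider (H) x y t where "(x, y) \<in> H" "0 \<le> t" "t < ?m" "X = x * ?m + t" "Y = y * ?m"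
    | (mult) x where "X = x * ?m"
  proof -
    from assms(2) consider x y t where "(x, y) \<in> H" "0 \<le> t" "t \<le> ?m" "X = x * ?m + t" "Y = y * ?m"
      | x where "X = x * ?m"
      unfolding subdivision_def by blast
    then show thesis
    proof cases
      case (1 x y t)
      show thesis
      proof (cases "t = ?m")
        case True
        then have "X = (x + 1) * ?m" using 1 by (simp add: algebra_simps)
        then show thesis by (rule mult)
      next
        case False
        then show thesis using 1 H by simp
      qed
    qed (rule mult)
  qed
  then show thesis
  proof cases
    case (mult x)
    from assms(3) consider x' y t where "(x', y) \<in> H" "0 \<le> t" "t \<le> ?m" "X + 1 = x' * ?m + t" "Y = y * ?m"
      | x' where "X + 1 = x' * ?m"
      unfolding subdivision_def by blast
    then show thesis
    proof cases
      case (1 x' y t)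
      have *: "x * ?m + 1 = x' * ?m + t" using 1 mult by simp
      have "t \<noteq> 0"
        using mult_add_eqD(2)[OF *] m by auto
      then have "x * ?m + 1 = x' * ?m + t" "\<bar>1 - t\<bar> < ?m" using * 1 by auto
      from mult_add_eqD[OF this] show thesis using 1 mult m by (intro that[of x' y 0]) auto
    next
      case (2 x')
      have "x * ?m + 1 = x' * ?m + 0" using 2 mult by simp
      then show thesis using mult_add_eqD(2)[of x ?m 1 x' 0] m by auto
    qed
  qed (rule that)
qed

text \<open>Reflection in the diagonal reduces vertical adjacency to the horizontal case.\<close>

lemma subdivision_swap:
  "(Y, X) \<in> subdivision (prod.swap ` V) (prod.swap ` H) m \<longleftrightarrow> (X, Y) \<in> subdivision H V m"
  unfolding subdivision_def Un_iff mem_Collect_eq pair_in_swap_image prod.inject by blast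

lemma subdivision_vertical:
  assumes m: "m \<ge> 2" and "(X, Y) \<in> subdivision H V m" "(X, Y + 1) \<in> subdivision H V m"
  obtains x y t where "(x, y) \<in> V" "0 \<le> t" "t < int m" "X = x * int m" "Y = y * int m + t"
proof -
  have "(Y, X) \<in> subdivision (prod.swap ` V) (prod.swap ` H) m"
    "(Y + 1, X) \<in> subdivision (prod.swap ` V) (prod.swap ` H) m"
    using assms(2,3) by (simp_all only: subdivision_swap)
  from subdivision_horizontal[OF m this] show thesis
    unfolding pair_in_swap_image using that by metis
qed

text \<open>On a corridor at least one of the two remainders is 0, so this is the linear
  interpolation of \<open>m * f\<close> along the corridor, with one formula for both
  directions.\<close>

fun interpolate :: "nat \<Rightarrow> (cell \<Rightarrow> int) \<Rightarrow> cell \<Rightarrow> int" where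
  "interpolate m f (X, Y) =
     (let x = X div int m; y = Y div int m in
      int m * f (x, y) + (X mod int m) * (f (x + 1, y) - f (x, y)) +
      (Y mod int m) * (f (x, y + 1) - f (x, y)))"

lemma interpolate_horizontal:
  assumes "m > 0" "0 \<le> t" "t \<le> int m"
  shows "interpolate m f (x * int m + t, y * int m) =
    int m * f (x, y) + t * (f (x + 1, y) - f (x, y))"
\<comment> \<open>At \<open>t = int m\<close> the quotient is already \<open>x + 1\<close> and the
  remainder 0; both expressions then equal \<open>m * f (x + 1, y)\<close>.\<close>
proof (cases "t = int m")
  case True
  then have "x * int m + t = (x + 1) * int m" by (simp add: algebra_simps)
  then show ?thesis using assms True by (simp add: algebra_simps del: of_nat_mult)
next
  case False
  then show ?thesis using assms by (simp add: Let_def)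
qed

lemma interpolate_vertical:
  assumes "m > 0" "0 \<le> t" "t \<le> int m"
  shows "interpolate m f (x * int m, y * int m + t) =
    int m * f (x, y) + t * (f (x, y + 1) - f (x, y))"
proof (cases "t = int m")
  case True
  then have "y * int m + t = (y + 1) * int m" by (simp add: algebra_simps)
  then show ?thesis using assms True by (simp add: algebra_simps del: of_nat_mult)
next
  case False
  then show ?thesis using assms by (simp add: Let_def)
qed

declare interpolate.simps [simp del]

lemma interpolate_scaled:
  "m > 0 \<Longrightarrow> interpolate m f (x * int m, y * int m) = int m * f (x, y)"
  using interpolate_horizontal[of m 0 f x y] by simp

text \<open>Adjacent cells lie on a common corridor, where the slope is the difference of
  \<open>f\<close> between the two ends of the grid edge. Stretching values and lengths by the same
  factor \<open>m\<close> thus keeps the Lipschitz constant.\<close>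

lemma interpolate_lipschitz:
  assumes m: "m \<ge> 2"
    and H: "\<And>x y. (x, y) \<in> H \<Longrightarrow> \<bar>f (x + 1, y) - f (x, y)\<bar> \<le> 1"
    and V: "\<And>x y. (x, y) \<in> V \<Longrightarrow> \<bar>f (x, y + 1) - f (x, y)\<bar> \<le> 1"
    and "(u, v) \<in> dual_edges (subdivision H V m)"
  shows "interpolate m f u \<le> interpolate m f v + 1"
proof -
  let ?F = "interpolate m f"
  have hor: "\<bar>?F (X + 1, Y) - ?F (X, Y)\<bar> \<le> 1"
    if XY: "(X, Y) \<in> subdivision H V m" "(X + 1, Y) \<in> subdivision H V m" for X Y
  proof -
    obtain x y t where *: "(x, y) \<in> H" "0 \<le> t" "t < int m" "X = x * int m + t" "Y = y * int m"
      using subdivision_horizontal[OF m XY] .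
    have "?F (x * int m + (t + 1), y * int m) - ?F (x * int m + t, y * int m) = f (x + 1, y) - f (x, y)"
      using m *(2,3) interpolate_horizontal[of m t f x y] interpolate_horizontal[of m "t + 1" f x y]
      by (simp add: distrib_right)
    then show ?thesis using H[OF *(1)] *(4,5) by (simp add: add.assoc)
  qed
  have ver: "\<bar>?F (X, Y + 1) - ?F (X, Y)\<bar> \<le> 1"
    if XY: "(X, Y) \<in> subdivision H V m" "(X, Y + 1) \<in> subdivision H V m" for X Y
  proof -
    obtain x y t where *: "(x, y) \<in> V" "0 \<le> t" "t < int m" "X = x * int m" "Y = y * int m + t"
      using subdivision_vertical[OF m XY] .
    have "?F (x * int m, y * int m + (t + 1)) - ?F (x * int m, y * int m + t) = f (x, y + 1) - f (x, y)"
      using m *(2,3) interpolate_vertical[of m t f x y] interpolate_vertical[of m "t + 1" f x y]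
      by (simp add: distrib_right)
    then show ?thesis using V[OF *(1)] *(4,5) by (simp add: add.assoc)
  qed
  from assms(4) show ?thesis
  proof (cases rule: dual_edges_cases)
    case (right X Y)
    then show ?thesis using hor[of X Y] by (simp add: abs_le_iff)
  next
    case (left X Y)
    then show ?thesis using hor[of X Y] by (simp add: abs_le_iff)
  next
    case (up X Y)
    then show ?thesis using ver[of X Y] by (simp add: abs_le_iff)
  next
    case (down X Y)
    then show ?thesis using ver[of X Y] by (simp add: abs_le_iff)
  qed
qed

section \<open>Distances between scaled vertices\<close>

definition scale_cell :: "nat \<Rightarrow> cell \<Rightarrow> cell" where
  "scale_cell m p = (fst p * int m, snd p * int m)"

definition grid_adj :: "cell set \<Rightarrow> cell set \<Rightarrow> cell \<Rightarrow> cell \<Rightarrow> bool" where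
  "grid_adj H V p q \<longleftrightarrow>
     p \<in> H \<and> q = (fst p + 1, snd p) \<or> q \<in> H \<and> p = (fst q + 1, snd q) \<or>
     p \<in> V \<and> q = (fst p, snd p + 1) \<or> q \<in> V \<and> p = (fst q, snd q + 1)"

lemma subdivision_path_H:
  assumes "(x, y) \<in> H" "t \<le> m"
  shows "((x * int m, y * int m), (x * int m + int t, y * int m))
    \<in> dual_edges (subdivision H V m) ^^ t"
  using assms(2)
proof (induction t)
  case (Suc t)
  have "(x * int m + int s, y * int m) \<in> subdivision H V m" if "s \<le> m" for s
    using assms(1) that by (intro subdivisionI) auto
  from this[of t] this[of "Suc t"] Suc.prems
  have "((x * int m + int t, y * int m), (x * int m + int (Suc t), y * int m))
      \<in> dual_edges (subdivision H V m)"
    by (simp add: dual_edges_def share_edge_def)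
  then show ?case using Suc by (intro relpow_Suc_I) auto
qed simp

lemma subdivision_path_V:
  assumes "(x, y) \<in> V" "t \<le> m"
  shows "((x * int m, y * int m), (x * int m, y * int m + int t))
    \<in> dual_edges (subdivision H V m) ^^ t"
  using assms(2)
proof (induction t)
  case (Suc t)
  have "(x * int m, y * int m + int s) \<in> subdivision H V m" if "s \<le> m" for s
    using assms(1) that by (intro subdivisionI) auto
  from this[of t] this[of "Suc t"] Suc.prems
  have "((x * int m, y * int m + int t), (x * int m, y * int m + int (Suc t)))
      \<in> dual_edges (subdivision H V m)"
    by (simp add: dual_edges_def share_edge_def)
  then show ?case using Suc by (intro relpow_Suc_I) auto
qed simp

lemma subdivision_path_adj:
  assumes "grid_adj H V p q"
  shows "(scale_cell m p, scale_cell m q) \<in> dual_edges (subdivision H V m) ^^ m"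
proof -
  obtain x y x' y' where [simp]: "p = (x, y)" "q = (x', y')" by fastforce
  from assms consider "(x, y) \<in> H" "x' = x + 1" "y' = y" | "(x', y') \<in> H" "x = x' + 1" "y' = y"
    | "(x, y) \<in> V" "x' = x" "y' = y + 1" | "(x', y') \<in> V" "x' = x" "y = y' + 1"
    by (auto simp: grid_adj_def)
  then show ?thesis
  proof cases
    case 1
    then show ?thesis using subdivision_path_H[of x y H m m V] by (simp add: scale_cell_def algebra_simps)
  next
    case 2
    then show ?thesis using subdivision_path_H[of x' y' H m m V, THEN relpow_dual_edges_sym]
      by (simp add: scale_cell_def algebra_simps)
  next
    case 3
    then show ?thesis using subdivision_path_V[of x y V m m H] by (simp add: scale_cell_def algebra_simps)
  next
    case 4
    then show ?thesis using subdivision_path_V[of x' y' V m m H, THEN relpow_dual_edges_sym]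
      by (simp add: scale_cell_def algebra_simps)
  qed
qed

definition vertices :: "cell set \<Rightarrow> cell set \<Rightarrow> cell set" where
  "vertices H V = H \<union> V \<union> (\<lambda>(x, y). (x + 1, y)) ` H \<union> (\<lambda>(x, y). (x, y + 1)) ` V"

text \<open>These conditions characterize \<open>f\<close> as the distance from \<open>v\<close> in the grid graph; being
  1-Lipschitz gives the lower bound, the descent along edges the upper bound.\<close>

definition distance_table :: "cell set \<Rightarrow> cell set \<Rightarrow> cell \<Rightarrow> (cell \<Rightarrow> int) \<Rightarrow> bool" where
  "distance_table H V v f \<longleftrightarrow> f v = 0 \<and> v \<in> vertices H V \<and>
     (\<forall>(x, y)\<in>H. \<bar>f (x + 1, y) - f (x, y)\<bar> \<le> 1) \<and>
     (\<forall>(x, y)\<in>V. \<bar>f (x, y + 1) - f (x, y)\<bar> \<le> 1) \<and>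
     (\<forall>(x, y)\<in>vertices H V. (x, y) = v \<or> 0 < f (x, y) \<and>
        ((x, y) \<in> H \<and> f (x + 1, y) + 1 = f (x, y) \<or>
         (x - 1, y) \<in> H \<and> f (x - 1, y) + 1 = f (x, y) \<or>
         (x, y) \<in> V \<and> f (x, y + 1) + 1 = f (x, y) \<or>
         (x, y - 1) \<in> V \<and> f (x, y - 1) + 1 = f (x, y)))"

lemma distance_table_descent:
  assumes "distance_table H V v f" "p \<in> vertices H V" "p \<noteq> v"
  shows "0 < f p \<and> (\<exists>q\<in>vertices H V. grid_adj H V p q \<and> f q + 1 = f p)"
proof -
  obtain x y where p: "p = (x, y)" by fastforce
  have step: "\<exists>q\<in>vertices H V. grid_adj H V p q \<and> f q + 1 = f p"
    if "grid_adj H V p q" "f q + 1 = f p" for q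
  proof -
    have "q \<in> vertices H V" using that(1) unfolding grid_adj_def vertices_def by force
    with that show ?thesis by blast
  qed
  have "0 < f p" and "p \<in> H \<and> f (x + 1, y) + 1 = f p \<or> (x - 1, y) \<in> H \<and> f (x - 1, y) + 1 = f p \<or>
      p \<in> V \<and> f (x, y + 1) + 1 = f p \<or> (x, y - 1) \<in> V \<and> f (x, y - 1) + 1 = f p"
    using assms unfolding distance_table_def p by auto
  then show ?thesis
    using step[of "(x + 1, y)"] step[of "(x - 1, y)"] step[of "(x, y + 1)"] step[of "(x, y - 1)"]
    by (auto simp: grid_adj_def p)
qed

lemma distance_table_nonneg: "distance_table H V v f \<Longrightarrow> p \<in> vertices H V \<Longrightarrow> 0 \<le> f p"
  using distance_table_descent[of H V v f p] by (cases "p = v") (auto simp: distance_table_def)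

text \<open>Each descent of \<open>f\<close> by 1 is realized by a corridor of \<open>m\<close>
  steps, and the value 0 is reached only at \<open>v\<close>.\<close>

lemma distance_table_path:
  assumes f: "distance_table H V v f" and "p \<in> vertices H V"
  shows "(scale_cell m p, scale_cell m v) \<in> dual_edges (subdivision H V m) ^^ (m * nat (f p))"
  using assms(2)
proof (induction "nat (f p)" arbitrary: p)
  case 0
  then have "p = v" using distance_table_descent[OF f 0(2)] by (cases "p = v") auto
  then show ?case using 0 by simp
next
  case (Suc n)
  then have "p \<noteq> v" using f unfolding distance_table_def by auto
  then obtain q where q: "q \<in> vertices H V" "grid_adj H V p q" "f q + 1 = f p"
    using distance_table_descent[OF f Suc.prems] by blast
  have n: "n = nat (f q)" using Suc.hyps(2) q(3) by linarith
  have "(scale_cell m q, scale_cell m v) \<in> dual_edges (subdivision H V m) ^^ (m * n)"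
    using Suc.hyps(1)[OF n q(1)] n by simp
  then have "(scale_cell m p, scale_cell m v) \<in> dual_edges (subdivision H V m) ^^ (m + m * n)"
    using subdivision_path_adj[OF q(2), of m] unfolding relpow_add by blast
  then show ?case by (simp flip: Suc.hyps(2))
qed

text \<open>The descending path gives the upper bound; the interpolated table, used as a potential,
  gives the matching lower bound.\<close>

lemma hop_dist_subdivision:
  assumes m: "m \<ge> 2" and f: "distance_table H V v f" and p: "p \<in> vertices H V"
  shows "hop_dist (subdivision H V m) (scale_cell m p) (scale_cell m v) = m * nat (f p)"
proof (rule antisym)
  note path = distance_table_path[OF f p, of m]
  show "hop_dist (subdivision H V m) (scale_cell m p) (scale_cell m v) \<le> m * nat (f p)"
    using path by (rule hop_dist_le)
  have "interpolate m f (scale_cell m p) - interpolate m f (scale_cell m v) \<le>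
      int (hop_dist (subdivision H V m) (scale_cell m p) (scale_cell m v))"
    using f unfolding distance_table_def
    by (intro hop_dist_ge[OF _ path] interpolate_lipschitz[OF m, of H f V]) auto
  moreover have "interpolate m f (scale_cell m q) = int m * f q" for q
    using m interpolate_scaled[of m f "fst q" "snd q"] by (simp add: scale_cell_def)
  moreover have "f v = 0" using f by (simp add: distance_table_def)
  ultimately have "int (m * nat (f p)) \<le> int (hop_dist (subdivision H V m) (scale_cell m p) (scale_cell m v))"
    using distance_table_nonneg[OF f p] by simp
  then show "m * nat (f p) \<le> hop_dist (subdivision H V m) (scale_cell m p) (scale_cell m v)"
    by (simp only: of_nat_le_iff)
qed

section \<open>Connectedness and shattering of subdivisions\<close>

lemma scale_cell_in_subdivision:
  assumes "p \<in> vertices H V"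
  shows "scale_cell m p \<in> subdivision H V m"
proof -
  obtain x y where p: "p = (x, y)" by fastforce
  from assms consider "(x, y) \<in> H" | "(x, y) \<in> V" | "(x - 1, y) \<in> H" | "(x, y - 1) \<in> V"
    by (auto simp: vertices_def p)
  then show ?thesis
  proof cases
    case 1
    then show ?thesis using subdivisionI(1)[of x y H 0 m V] by (simp add: p scale_cell_def)
  next
    case 2
    then show ?thesis using subdivisionI(2)[of x y V 0 m H] by (simp add: p scale_cell_def)
  next
    case 3
    then show ?thesis using subdivisionI(1)[of "x - 1" y H "int m" m V]
      by (simp add: p scale_cell_def algebra_simps)
  next
    case 4
    then show ?thesis using subdivisionI(2)[of x "y - 1" V "int m" m H]
      by (simp add: p scale_cell_def algebra_simps)
  qed
qed

text \<open>The table also certifies connectedness: every cell reaches a vertex along its corridor,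
  and every vertex descends to \<open>v\<close>.\<close>

lemma polyomino_subdivision:
  assumes "finite H" "finite V" and f: "distance_table H V v f"
  shows "polyomino (subdivision H V m)"
proof -
  let ?P = "subdivision H V m"
  let ?R = "dual_edges ?P"
  have to_v: "(u, scale_cell m v) \<in> ?R\<^sup>*" if "u \<in> ?P" for u
  proof -
    have "\<exists>p\<in>vertices H V. (scale_cell m p, u) \<in> ?R\<^sup>*"
    proof -
      from that consider (H) x y t where "(x, y) \<in> H" "0 \<le> t" "t \<le> int m" "u = (x * int m + t, y * int m)"
        | (V) x y t where "(x, y) \<in> V" "0 \<le> t" "t \<le> int m" "u = (x * int m, y * int m + t)"
        unfolding subdivision_def by blast
      then show ?thesis
      proof cases
        case (H x y t)
        then have "(scale_cell m (x, y), u) \<in> ?R ^^ nat t"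
          using subdivision_path_H[of x y H "nat t" m V] by (simp add: scale_cell_def)
        then show ?thesis using H(1)
          by (intro bexI[of _ "(x, y)"] relpow_imp_rtrancl) (auto simp: vertices_def)
      next
        case (V x y t)
        then have "(scale_cell m (x, y), u) \<in> ?R ^^ nat t"
          using subdivision_path_V[of x y V "nat t" m H] by (simp add: scale_cell_def)
        then show ?thesis using V(1)
          by (intro bexI[of _ "(x, y)"] relpow_imp_rtrancl) (auto simp: vertices_def)
      qed
    qed
    then obtain p where "p \<in> vertices H V" "(u, scale_cell m p) \<in> ?R\<^sup>*"
      using sym_rtrancl[OF sym_dual_edges] by (metis symE)
    then show ?thesis
      using relpow_imp_rtrancl[OF distance_table_path[OF f, of p m]] by (metis rtrancl_trans)
  qed
  moreover have "scale_cell m v \<in> ?P" using f scale_cell_in_subdivision by (auto simp: distance_table_def)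
  moreover have "(u, w) \<in> ?R\<^sup>*" if "u \<in> ?P" "w \<in> ?P" for u w
    using to_v[OF that(1)] to_v[OF that(2)] sym_rtrancl[OF sym_dual_edges[of ?P]]
    by (metis rtrancl_trans symE)
  ultimately show ?thesis
    using finite_subdivision[OF assms(1,2)] unfolding polyomino_def by blast
qed

lemma inj_scale_cell: "m > 0 \<Longrightarrow> inj (scale_cell m)"
  by (auto simp: inj_def scale_cell_def)

text \<open>Scaled vertices have distances that are multiples of \<open>m\<close>, so between them
  radius \<open>k\<close> acts like radius \<open>r\<close> in the grid graph.\<close>

lemma shattered_subdivision:
  assumes m: "m \<ge> 2" and k: "m * r \<le> k" "k < m * (r + 1)"
    and G: "finite G" "\<And>g. g \<in> G \<Longrightarrow> distance_table H V g (f g)"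
    and traces: "\<And>S. S \<subseteq> G \<Longrightarrow> \<exists>u\<in>vertices H V. \<forall>g\<in>G. f g u \<le> int r \<longleftrightarrow> g \<in> S"
  shows "shattered k (subdivision H V m) (scale_cell m ` G)"
proof -
  let ?P = "subdivision H V m"
  have GV: "g \<in> vertices H V" if "g \<in> G" for g
    using G(2)[OF that] by (simp add: distance_table_def)
  have vis: "hop_visible k ?P (scale_cell m u) (scale_cell m g) \<longleftrightarrow> f g u \<le> int r"
    if "u \<in> vertices H V" "g \<in> G" for u g
  proof -
    have "hop_visible k ?P (scale_cell m u) (scale_cell m g) \<longleftrightarrow> m * nat (f g u) \<le> k"
      using that GV by (simp add: hop_visible_def scale_cell_in_subdivision hop_dist_subdivision[OF m G(2)])
    also have "\<dots> \<longleftrightarrow> nat (f g u) \<le> r"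
    proof
      assume "m * nat (f g u) \<le> k"
      then have "m * nat (f g u) < m * (r + 1)" using k(2) by simp
      then have "nat (f g u) < r + 1" by (simp only: mult_less_cancel1)
      then show "nat (f g u) \<le> r" by simp
    next
      assume "nat (f g u) \<le> r"
      then show "m * nat (f g u) \<le> k" using k(1) by (meson le_trans mult_le_mono2)
    qed
    finally show ?thesis by linarith
  qed
  have "\<exists>u\<in>?P. (\<forall>v\<in>S. hop_visible k ?P u v) \<and> (\<forall>v\<in>scale_cell m ` G - S. \<not> hop_visible k ?P u v)"
    if S: "S \<subseteq> scale_cell m ` G" for S
  proof -
    have "{g \<in> G. scale_cell m g \<in> S} \<subseteq> G" by blast
    from traces[OF this] obtain u where u: "u \<in> vertices H V"
      "\<And>g. g \<in> G \<Longrightarrow> f g u \<le> int r \<longleftrightarrow> scale_cell m g \<in> S" by blast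
    have *: "hop_visible k ?P (scale_cell m u) v \<longleftrightarrow> v \<in> S" if "v \<in> scale_cell m ` G" for v
      using that vis[OF u(1)] u(2) by (elim imageE) simp
    show ?thesis
    proof (intro bexI[of _ "scale_cell m u"] conjI ballI)
      show "scale_cell m u \<in> ?P" by (rule scale_cell_in_subdivision[OF u(1)])
      show "hop_visible k ?P (scale_cell m u) v" if "v \<in> S" for v
        using * S that by blast
      show "\<not> hop_visible k ?P (scale_cell m u) v" if "v \<in> scale_cell m ` G - S" for v
        using * that by blast
    qed
  qed
  moreover have "scale_cell m ` G \<subseteq> ?P" using GV scale_cell_in_subdivision by blast
  ultimately show ?thesis using G(1) by (simp add: shattered_def)
qed

section \<open>The dual drawing and its inner faces\<close>

lemma dual_drawing_subdivision:
  assumes m: "m \<ge> 2" and "(a, b) \<in> dual_drawing (subdivision H V m)"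
  shows "\<exists>z :: int. a = of_int (z * int m) \<or> b = of_int (z * int m)"
proof -
  let ?P = "subdivision H V m"
  from assms(2) consider u where "u \<in> ?P" "(a, b) = center u"
    | u v where "(u, v) \<in> dual_edges ?P" "(a, b) \<in> closed_segment (center u) (center v)"
    unfolding dual_drawing_def by blast
  then show ?thesis
  proof cases
    case (1 u)
    then show ?thesis by (auto simp: subdivision_def center_def)
  next
    case (2 u v)
    then obtain s where s: "(a, b) = (1 - s) *\<^sub>R center u + s *\<^sub>R center v"
      by (auto simp: closed_segment_def)
    have const: "(1 - s) * c + s * c = c" for c :: real by (simp add: algebra_simps)
    \<comment> \<open>A dual edge runs along a corridor, so its constant coordinate is a multiple of
      \<open>m\<close>.\<close>
    have hor: "\<exists>z. Y = z * int m" if XY: "(X, Y) \<in> ?P" "(X + 1, Y) \<in> ?P" for X Y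
      using subdivision_horizontal[OF m XY] by metis
    have ver: "\<exists>z. X = z * int m" if XY: "(X, Y) \<in> ?P" "(X, Y + 1) \<in> ?P" for X Y
      using subdivision_vertical[OF m XY] by metis
    from 2(1) show ?thesis
    proof (cases rule: dual_edges_cases)
      case (right X Y)
      then have "b = of_int Y" "\<exists>z. Y = z * int m" using s const hor[of X Y] by (simp_all add: center_def)
      then show ?thesis by blast
    next
      case (left X Y)
      then have "b = of_int Y" "\<exists>z. Y = z * int m" using s const hor[of X Y] by (simp_all add: center_def)
      then show ?thesis by blast
    next
      case (up X Y)
      then have "a = of_int X" "\<exists>z. X = z * int m" using s const ver[of X Y] by (simp_all add: center_def)
      then show ?thesis by blast
    next
      case (down X Y)
      then have "a = of_int X" "\<exists>z. X = z * int m" using s const ver[of X Y] by (simp_all add: center_def)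
      then show ?thesis by blast
    qed
  qed
qed

lemma dual_drawing_H:
  assumes "(x, y) \<in> H" "of_int (x * int m) \<le> a" "a \<le> of_int ((x + 1) * int m)"
  shows "(a, of_int (y * int m)) \<in> dual_drawing (subdivision H V m)"
proof -
  let ?P = "subdivision H V m"
  have mem: "(x * int m + t, y * int m) \<in> ?P" if "0 \<le> t" "t \<le> int m" for t
    using assms(1) that by (rule subdivisionI)
  define t where "t = \<lfloor>a\<rfloor> - x * int m"
  have "x * int m \<le> \<lfloor>a\<rfloor>" using assms(2) by (simp only: le_floor_iff)
  then have t: "t \<ge> 0" by (simp add: t_def)
  have fl: "of_int \<lfloor>a\<rfloor> \<le> a" "a < of_int \<lfloor>a\<rfloor> + 1" by linarith+
  show ?thesis
  proof (cases "t < int m")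
    case True
    let ?u = "(\<lfloor>a\<rfloor>, y * int m)" and ?v = "(\<lfloor>a\<rfloor> + 1, y * int m)"
    have "?u \<in> ?P" "?v \<in> ?P"
      using mem[of t] mem[of "t + 1"] t True by (simp_all add: t_def)
    then have "(?u, ?v) \<in> dual_edges ?P" by (simp add: dual_edges_def share_edge_def)
    moreover have "(a, of_int (y * int m)) \<in> closed_segment (center ?u) (center ?v)"
      unfolding closed_segment_def center_def using fl
      by (intro CollectI exI[of _ "a - of_int \<lfloor>a\<rfloor>"]) (auto simp: algebra_simps)
    ultimately show ?thesis unfolding dual_drawing_def by blast
  next
    \<comment> \<open>Here \<open>a\<close> is the right end of the corridor, where no unit edge
      starts within the corridor; the center of the last cell covers it.\<close>
    case False
    then have "(x + 1) * int m \<le> \<lfloor>a\<rfloor>" by (simp add: t_def algebra_simps)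
    then have "a = of_int ((x + 1) * int m)"
      using assms(3) by (meson antisym le_floor_iff)
    moreover have "((x + 1) * int m, y * int m) \<in> ?P"
      using mem[of "int m"] by (simp add: algebra_simps)
    then have "center ((x + 1) * int m, y * int m) \<in> dual_drawing ?P"
      unfolding dual_drawing_def by blast
    ultimately show ?thesis by (simp add: center_def)
  qed
qed

lemma dual_drawing_V:
  assumes "(x, y) \<in> V" "of_int (y * int m) \<le> b" "b \<le> of_int ((y + 1) * int m)"
  shows "(of_int (x * int m), b) \<in> dual_drawing (subdivision H V m)"
proof -
  let ?P = "subdivision H V m"
  have mem: "(x * int m, y * int m + t) \<in> ?P" if "0 \<le> t" "t \<le> int m" for t
    using assms(1) that by (rule subdivisionI)
  define t where "t = \<lfloor>b\<rfloor> - y * int m"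
  have "y * int m \<le> \<lfloor>b\<rfloor>" using assms(2) by (simp only: le_floor_iff)
  then have t: "t \<ge> 0" by (simp add: t_def)
  have fl: "of_int \<lfloor>b\<rfloor> \<le> b" "b < of_int \<lfloor>b\<rfloor> + 1" by linarith+
  show ?thesis
  proof (cases "t < int m")
    case True
    let ?u = "(x * int m, \<lfloor>b\<rfloor>)" and ?v = "(x * int m, \<lfloor>b\<rfloor> + 1)"
    have "?u \<in> ?P" "?v \<in> ?P"
      using mem[of t] mem[of "t + 1"] t True by (simp_all add: t_def)
    then have "(?u, ?v) \<in> dual_edges ?P" by (simp add: dual_edges_def share_edge_def)
    moreover have "(of_int (x * int m), b) \<in> closed_segment (center ?u) (center ?v)"
      unfolding closed_segment_def center_def using fl
      by (intro CollectI exI[of _ "b - of_int \<lfloor>b\<rfloor>"]) (auto simp: algebra_simps)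
    ultimately show ?thesis unfolding dual_drawing_def by blast
  next
    case False
    then have "(y + 1) * int m \<le> \<lfloor>b\<rfloor>" by (simp add: t_def algebra_simps)
    then have "b = of_int ((y + 1) * int m)"
      using assms(3) by (meson antisym le_floor_iff)
    moreover have "(x * int m, (y + 1) * int m) \<in> ?P"
      using mem[of "int m"] by (simp add: algebra_simps)
    then have "center (x * int m, (y + 1) * int m) \<in> dual_drawing ?P"
      unfolding dual_drawing_def by blast
    ultimately show ?thesis by (simp add: center_def)
  qed
qed

lemma measure_box_square: "d \<ge> 0 \<Longrightarrow> measure lebesgue (box (a, b) (a + d, b + d)) = d * (d :: real)"
  by (simp add: measure_lborel_box_eq Basis_prod_def inner_Pair_0 sum.union_disjoint prod.union_disjoint)

text \<open>The four edges bound a unit square of the grid graph. Its scaled interior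
  \<open>B\<close> avoids the drawing, which lies on lines of spacing \<open>m\<close>, while its
  frontier is drawn, so \<open>B\<close> is an inner face of area \<open>m * m\<close>.\<close>

lemma not_simple_subdivision:
  assumes m: "m \<ge> 2" and "(x, y) \<in> H" "(x, y + 1) \<in> H" "(x, y) \<in> V" "(x + 1, y) \<in> V"
  shows "\<not> simple_polyomino (subdivision H V m)"
proof -
  let ?D = "dual_drawing (subdivision H V m)"
  define l where "l z = real_of_int (z * int m)" for z
  have l: "l (z + 1) = l z + real m" for z by (simp add: l_def algebra_simps)
  define B where "B = box (l x, l y) (l x + real m, l y + real m)"
  have B: "(a, b) \<in> B \<longleftrightarrow> l x < a \<and> a < l x + real m \<and> l y < b \<and> b < l y + real m" for a b
    by (auto simp: B_def mem_box Basis_prod_def)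
  have gap: "\<not> (l x < l z \<and> l z < l x + real m)" for x z
  proof
    assume "l x < l z \<and> l z < l x + real m"
    then have "x * int m < z * int m" "z * int m < (x + 1) * int m"
      unfolding l[symmetric] unfolding l_def by (simp_all only: of_int_less_iff)
    moreover have "0 < int m" using m by simp
    ultimately have "x < z" "z < x + 1" by (simp_all only: mult_less_cancel_right_pos)
    then show False by simp
  qed
  have BD: "B \<subseteq> - ?D"
  proof
    fix p assume "p \<in> B"
    obtain a b where p: "p = (a, b)" by fastforce
    have "(a, b) \<notin> ?D"
    proof
      assume "(a, b) \<in> ?D"
      then obtain z where "a = l z \<or> b = l z"
        using dual_drawing_subdivision[OF m] unfolding l_def by blast
      then show False using \<open>p \<in> B\<close> gap unfolding p B by blast
    qed
    then show "p \<in> - ?D" by (simp add: p)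
  qed
  have fr: "frontier B \<subseteq> ?D"
  proof
    fix p assume p': "p \<in> frontier B"
    obtain a b where p: "p = (a, b)" by fastforce
    have "closure B \<subseteq> cbox (l x, l y) (l x + real m, l y + real m)"
      unfolding B_def by (rule closure_minimal[OF box_subset_cbox closed_cbox])
    moreover have "interior B = B"
      unfolding B_def by (rule interior_open[OF open_box])
    ultimately have "frontier B \<subseteq> cbox (l x, l y) (l x + real m, l y + real m) - B"
      unfolding frontier_def by blast
    with p' have n: "(a, b) \<notin> B" and "(a, b) \<in> cbox (l x, l y) (l x + real m, l y + real m)"
      unfolding p by blast+
    then have c: "l x \<le> a" "a \<le> l x + real m" "l y \<le> b" "b \<le> l y + real m"
      by (simp_all add: cbox_Pair_eq)
    with n have "a = l x \<or> a = l (x + 1) \<or> b = l y \<or> b = l (y + 1)"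
      unfolding B l by linarith
    moreover have "(a, l y') \<in> ?D" if "(x, y') \<in> H" for y'
      using c(1,2) unfolding l[symmetric] unfolding l_def by (rule dual_drawing_H[OF that])
    moreover have "(l x', b) \<in> ?D" if "(x', y) \<in> V" for x'
      using c(3,4) unfolding l[symmetric] unfolding l_def by (rule dual_drawing_V[OF that])
    ultimately show "p \<in> ?D" unfolding p using assms(2-5) by blast
  qed
  have "B \<noteq> {}"
  proof -
    have "(l x + real m / 2, l y + real m / 2) \<in> B" unfolding B using m by auto
    then show ?thesis by blast
  qed
  have "B \<in> components (- ?D)"
    unfolding in_components_maximal
  proof (intro conjI allI impI)
    show "connected B" unfolding B_def by (rule convex_connected) (rule convex_box)
    fix C assume C: "C \<noteq> {} \<and> B \<subseteq> C \<and> C \<subseteq> - ?D \<and> connected C"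
    \<comment> \<open>A connected set that contains \<open>B\<close> and also leaves it would meet
      the frontier of \<open>B\<close>, hence the drawing.\<close>
    have "C - B = {}"
      using connected_Int_frontier[of C B] C fr \<open>B \<noteq> {}\<close> by blast
    then show "C = B" using C by blast
  qed (fact | rule BD)+
  moreover have "bounded B" by (simp add: B_def)
  moreover have "measure lebesgue B = real m * real m"
    unfolding B_def by (rule measure_box_square) simp
  moreover have "real m * real m \<noteq> 1"
  proof -
    have "2 * 2 \<le> real m * real m" using m by (intro mult_mono) auto
    then have "1 < real m * real m" by (rule less_le_trans[rotated]) simp
    then show ?thesis by (rule less_imp_neq[symmetric])
  qed
  ultimately show ?thesis
    unfolding simple_polyomino_def inner_faces_def by auto
qed

section \<open>Four shattered cells\<close>

text \<open>The following grid graph with guards \<open>A = (3, 3)\<close>, \<open>B = (0, 4)\<close>, \<open>C = (1, 0)\<close>,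
  \<open>D = (3, 4)\<close>, shattered by balls of radius 4, was found by a computer search.\<close>

(*
    B  +--+--D--+
    |  |        |
    +--+  +--A  +
    |  |  |     |
    +--+--+--+--+
    |        |  |
    +        +--+
    |        |  |
    +--C--+--+  +
*)

definition example_H :: "cell set" where
  "example_H = {(0, 0), (1, 0), (2, 0), (3, 1), (0, 2), (1, 2), (2, 2), (3, 2), (0, 3), (2, 3),
     (1, 4), (2, 4), (3, 4)}"

definition example_V :: "cell set" where
  "example_V = {(0, 0), (3, 0), (4, 0), (0, 1), (3, 1), (4, 1), (0, 2), (1, 2), (2, 2), (4, 2),
     (0, 3), (1, 3), (4, 3)}"

definition example_guards :: "cell set" where
  "example_guards = {(3, 3), (0, 4), (1, 0), (3, 4)}"

text \<open>The rows of the tables list increasing \<open>y\<close>; entries at lattice points outside the graph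
  are arbitrary.\<close>

definition example_dist :: "cell \<Rightarrow> cell \<Rightarrow> int" where
  "example_dist g p =
     (if g = (3, 3) then
        [[6, 7, 6, 5, 6], [5, 0, 0, 4, 5], [4, 3, 2, 3, 4], [5, 4, 1, 0, 5], [6, 5, 6, 7, 6]]
      else if g = (0, 4) then
        [[4, 5, 6, 7, 8], [3, 0, 0, 6, 7], [2, 3, 4, 5, 6], [1, 2, 5, 6, 7], [0, 3, 4, 5, 6]]
      else if g = (1, 0) then
        [[1, 0, 1, 2, 5], [2, 0, 0, 3, 4], [3, 4, 5, 4, 5], [4, 5, 6, 7, 6], [5, 6, 7, 8, 7]]
      else
        [[7, 8, 7, 6, 5], [6, 0, 0, 5, 4], [5, 4, 5, 4, 3], [4, 3, 6, 7, 2], [5, 2, 1, 0, 1]])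
     ! nat (snd p) ! nat (fst p)"

lemma example_distance_table:
  "\<forall>g\<in>example_guards. distance_table example_H example_V g (example_dist g)"
  by code_simp

lemma example_traces:
  "\<forall>S\<in>Pow example_guards. \<exists>u\<in>vertices example_H example_V.
     \<forall>g\<in>example_guards. example_dist g u \<le> 4 \<longleftrightarrow> g \<in> S"
  by code_simp

lemma example_shattered:
  assumes "k \<ge> 16"
  obtains P D where "polyomino_with_holes P" "shattered k P D" "card D = 4"
proof
  define m where "m = k div 4"
  have m: "m \<ge> 4" using assms by (simp add: m_def)
  let ?P = "subdivision example_H example_V m"
  have "finite example_H" "finite example_V"
    by (simp_all add: example_H_def example_V_def)
  moreover have "distance_table example_H example_V (1, 0) (example_dist (1, 0))"
    using example_distance_table by (simp add: example_guards_def)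
  ultimately have "polyomino ?P" by (rule polyomino_subdivision)
  moreover have "\<not> simple_polyomino ?P"
    \<comment> \<open>The unit square with lower left corner \<open>(3, 1)\<close> has all four
      sides in the graph.\<close>
    using m by (intro not_simple_subdivision[of _ 3 1]) (auto simp: example_H_def example_V_def)
  ultimately show "polyomino_with_holes ?P" by (simp add: polyomino_with_holes_def)
  \<comment> \<open>\<open>k\<close> is at most \<open>4 * m + 3\<close>, which is below
    \<open>5 * m\<close> because \<open>m \<ge> 4\<close>; this is the source of the bound
    16.\<close>
  have "m * 4 \<le> k" "k < m * (4 + 1)" using m by (auto simp: m_def)
  then show "shattered k ?P (scale_cell m ` example_guards)"
    using m example_distance_table example_traces
    by (intro shattered_subdivision[of _ 4 _ _ _ _ example_dist]) (auto simp: example_guards_def)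
  show "card (scale_cell m ` example_guards) = 4"
    using m by (subst card_image[OF inj_on_subset[OF inj_scale_cell subset_UNIV]]) (auto simp: example_guards_def)
qed

theorem theorem7:
  "\<exists>k0::nat. \<forall>k\<ge>k0.
     has_vc_dimension k {P. polyomino_with_holes P} 4 \<and>
     has_vc_dimension k {P. polyomino P} 4"
proof (intro exI[of _ 16] allI impI)
  fix k :: nat assume "16 \<le> k"
  then obtain P D where P: "polyomino_with_holes P" and D: "shattered k P D" "card D = 4"
    by (rule example_shattered)
  \<comment> \<open>The same witness serves both classes, and the upper bound holds for every
    polyomino.\<close>
  have "polyomino P" using P by (simp add: polyomino_with_holes_def)
  with P D show "has_vc_dimension k {P. polyomino_with_holes P} 4 \<and>
      has_vc_dimension k {P. polyomino P} 4"
    unfolding has_vc_dimension_def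
    using shattered_card_le_4 by (auto simp: polyomino_with_holes_def)
qed

end
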